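(* For every integer $n\geq 1$, $$A_{n}(t)=\frac{(1+t^{2})^{n}}{2(1+t)^{n-1}}P_{n}^{\mathrm{udr}}\left(\frac{2t}{1+t^{2}}\right).$$ Equivalently, $$P_{n}^{\mathrm{udr}}(t)=\frac{2(1+v)^{n-1}}{(1+v^{2})^{n}}A_{n}(v),\qquad\text{where } v=\frac{1-\sqrt{1-t^{2}}}{t}.$$
   Context: $\mathfrak{S}_n$ is the set of permutations $\pi=\pi_1\cdots\pi_n$ of $[n]=\{1,\dots,n\}$. For $\pi\in\mathfrak{S}_n$, $\mathrm{des}(\pi)$ is the number of $i\in[n-1]$ with $\pi_i>\pi_{i+1}$, and $A_n(t)=\sum_{\pi\in\mathfrak{S}_n}t^{\mathrm{des}(\pi)+1}$ ($n\ge1$). An increasing run of $\pi$ is a maximal increasing consecutive subsequence. A birun of $\pi$ is a maximal monotone (increasing or decreasing) consecutive subsequence of length at least two. An up-down run of $\pi$ is either a birun of $\pi$, or the letter $\pi_1$ if it is an increasing run of length $1$. $\mathrm{udr}(\pi)$ is the number of up-down runs of $\pi$ (e.g. $\mathrm{udr}(85712643)=6$, the up-down runs being $8,85,57,71,126,643$). $P_n^{\mathrm{udr}}(t)=\sum_{\pi\in\mathfrak{S}_n}t^{\mathrm{udr}(\pi)}$. In the second identity, $\sqrt{1-t^2}$ is the formal power series in $t$ with constant term $1$, so that $v$ is a formal power series in $t$. *)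

theory Defs
  imports "HOL-Combinatorics.Permutations" "HOL-Computational_Algebra.Polynomial_FPS" Complex_Main
begin

text \<open>A permutation of \<open>[n]\<close> is a function with \<open>\<pi> permutes {1..n}\<close>; \<open>\<pi> i\<close> is its \<open>i\<close>-th letter.
  Since the letters are distinct, a nonempty consecutive subsequence is identified with its
  interval of positions.\<close>

definition des :: "nat \<Rightarrow> (nat \<Rightarrow> nat) \<Rightarrow> nat" where
  "des n \<pi> = card {i \<in> {1..<n}. \<pi> i > \<pi> (i + 1)}"

definition segment :: "nat \<Rightarrow> nat set \<Rightarrow> bool" where
  "segment n S \<longleftrightarrow> (\<exists>i j. 1 \<le> i \<and> i \<le> j \<and> j \<le> n \<and> S = {i..j})"

definition increasing_segment :: "nat \<Rightarrow> (nat \<Rightarrow> nat) \<Rightarrow> nat set \<Rightarrow> bool" where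
  "increasing_segment n \<pi> S \<longleftrightarrow> segment n S \<and> strict_mono_on S \<pi>"

definition monotone_segment :: "nat \<Rightarrow> (nat \<Rightarrow> nat) \<Rightarrow> nat set \<Rightarrow> bool" where
  "monotone_segment n \<pi> S \<longleftrightarrow> segment n S \<and> (strict_mono_on S \<pi> \<or> strict_antimono_on S \<pi>)"

definition increasing_run :: "nat \<Rightarrow> (nat \<Rightarrow> nat) \<Rightarrow> nat set \<Rightarrow> bool" where
  "increasing_run n \<pi> S \<longleftrightarrow>
     increasing_segment n \<pi> S \<and> (\<forall>T. increasing_segment n \<pi> T \<and> S \<subseteq> T \<longrightarrow> T = S)"

definition birun :: "nat \<Rightarrow> (nat \<Rightarrow> nat) \<Rightarrow> nat set \<Rightarrow> bool" where
  "birun n \<pi> S \<longleftrightarrow>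
     monotone_segment n \<pi> S \<and> (\<forall>T. monotone_segment n \<pi> T \<and> S \<subseteq> T \<longrightarrow> T = S) \<and> card S \<ge> 2"

definition up_down_run :: "nat \<Rightarrow> (nat \<Rightarrow> nat) \<Rightarrow> nat set \<Rightarrow> bool" where
  "up_down_run n \<pi> S \<longleftrightarrow> birun n \<pi> S \<or> (S = {1} \<and> increasing_run n \<pi> S)"

definition udr :: "nat \<Rightarrow> (nat \<Rightarrow> nat) \<Rightarrow> nat" where
  "udr n \<pi> = card {S. up_down_run n \<pi> S}"

definition eulerian_poly :: "nat \<Rightarrow> real poly" where
  "eulerian_poly n = (\<Sum>\<pi> | \<pi> permutes {1..n}. monom 1 (des n \<pi> + 1))"

definition udr_poly :: "nat \<Rightarrow> real poly" where
  "udr_poly n = (\<Sum>\<pi> | \<pi> permutes {1..n}. monom 1 (udr n \<pi>))"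

text \<open>Evaluation of a polynomial at a formal power series. The substituted series should have
  constant term 0, since \<^const>\<open>fps_compose\<close> ignores a nonzero constant term.\<close>

definition poly_at :: "real poly \<Rightarrow> real fps \<Rightarrow> real fps" where
  "poly_at p f = fps_compose (fps_of_poly p) f"

definition sqrt_one_minus_X2 :: "real fps" where
  "sqrt_one_minus_X2 = fps_radical root 2 (1 - fps_X ^ 2)"

definition v_series :: "real fps" where
  "v_series = (1 - sqrt_one_minus_X2) / fps_X"

lemma sqrt_one_minus_X2_iff:
  "s = sqrt_one_minus_X2 \<longleftrightarrow> s ^ 2 = 1 - fps_X ^ 2 \<and> fps_nth s 0 = 1"
proof -
  have *: "fps_nth (sqrt_one_minus_X2) 0 = 1"
    by (simp add: sqrt_one_minus_X2_def numeral_2_eq_2)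
  have sq: "sqrt_one_minus_X2 ^ 2 = 1 - fps_X ^ 2"
    using power_radical[of "1 - fps_X ^ 2 :: real fps" root 1]
    by (simp add: sqrt_one_minus_X2_def numeral_2_eq_2)
  show ?thesis
  proof
    assume a: "s ^ 2 = 1 - fps_X ^ 2 \<and> fps_nth s 0 = 1"
    then have "s ^ 2 = sqrt_one_minus_X2 ^ 2" by (simp add: sq)
    then have "s = sqrt_one_minus_X2 \<or> s = - sqrt_one_minus_X2"
      by (simp add: power2_eq_iff)
    moreover have "s \<noteq> - sqrt_one_minus_X2"
      using a * by (metis fps_neg_nth one_neq_neg_one)
    ultimately show "s = sqrt_one_minus_X2" by simp
  qed (use * sq in auto)
qed

lemma X_times_v_series: "fps_X * v_series = 1 - sqrt_one_minus_X2"
proof -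
  have "fps_nth (1 - sqrt_one_minus_X2) 0 = 0"
    using sqrt_one_minus_X2_iff[of sqrt_one_minus_X2] by simp
  then have "fps_X dvd 1 - sqrt_one_minus_X2"
    using fps_dvd_iff[of fps_X "1 - sqrt_one_minus_X2"] subdegree_eq_0_iff[of "1 - sqrt_one_minus_X2"]
    by (cases "1 - sqrt_one_minus_X2 = 0") auto
  then show ?thesis unfolding v_series_def by (rule dvd_mult_div_cancel)
qed

lemma v_series_nth_0: "fps_nth v_series 0 = 0"
proof -
  have "fps_nth (sqrt_one_minus_X2 ^ 2) 1 = fps_nth (1 - fps_X ^ 2 :: real fps) 1"
    using sqrt_one_minus_X2_iff[of sqrt_one_minus_X2] by simp
  moreover have "fps_nth sqrt_one_minus_X2 0 = 1"
    using sqrt_one_minus_X2_iff[of sqrt_one_minus_X2] by simp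
  ultimately have "fps_nth sqrt_one_minus_X2 1 = 0"
    by (simp add: power2_eq_square fps_mult_nth)
  then have "fps_nth (fps_X * v_series) 1 = 0"
    by (simp add: X_times_v_series)
  then show ?thesis by simp
qed

end

theory Submission
  imports Defs
begin

text \<open>Inserting the letter \<open>n + 1\<close> into a permutation of \<open>[n]\<close> with \<open>r\<close> up-down runs leaves the
  number of runs unchanged in \<open>r\<close> places, raises it by 1 in one place and by 2 in the other
  \<open>n - r\<close> places. Hence \<open>P\<^sub>n\<^sub>+\<^sub>1 = t (1 - t\<^sup>2) P\<^sub>n' + (t + n t\<^sup>2) P\<^sub>n\<close>, to be compared with
  \<open>A\<^sub>n\<^sub>+\<^sub>1 = t (1 - t) A\<^sub>n' + (n + 1) t A\<^sub>n\<close>. With \<open>u = 2 t / (1 + t\<^sup>2)\<close>, both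
  \<open>(1 + t\<^sup>2)\<^sup>n P\<^sub>n(u)\<close> and \<open>2 (1 + t)\<^sup>n\<^sup>-\<^sup>1 A\<^sub>n\<close> satisfy
  \<open>E\<^sub>n\<^sub>+\<^sub>1 = t (1 - t\<^sup>2) E\<^sub>n' + 2 t (1 + n t) E\<^sub>n\<close>, so they agree. The second identity follows
  since \<open>v\<close> is the compositional inverse of \<open>u\<close>.\<close>

subsection \<open>Words of ascents and descents\<close>

text \<open>Since \<open>\<pi> 0 = 0\<close> for \<open>\<pi> permutes {1..n}\<close>, the word starts with the ascent from a virtual
  letter 0 to \<open>\<pi> 1\<close>; its maximal constant blocks then correspond to the up-down runs.\<close>

definition ascent_word :: "nat \<Rightarrow> (nat \<Rightarrow> nat) \<Rightarrow> bool list" where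
  "ascent_word n \<pi> = map (\<lambda>i. \<pi> i < \<pi> (Suc i)) [0..<n]"

lemma length_ascent_word [simp]: "length (ascent_word n \<pi>) = n"
  by (simp add: ascent_word_def)

lemma permutes_0: "\<pi> permutes {1..n} \<Longrightarrow> \<pi> 0 = (0::nat)"
  by (rule permutes_not_in) auto

lemma permutes_pos: "\<pi> permutes {1..n} \<Longrightarrow> i > 0 \<Longrightarrow> \<pi> i > (0::nat)"
  using permutes_0[of \<pi> n] permutes_inj[of \<pi> "{1..n}"] by (metis gr0I injD)

lemma permutes_le: "\<pi> permutes {1..n} \<Longrightarrow> i \<le> n \<Longrightarrow> \<pi> i \<le> (n::nat)"
  using permutes_0[of \<pi> n] permutes_in_seg[of \<pi> n i] by (cases "i = 0") auto

lemma hd_ascent_word: "\<pi> permutes {1..n} \<Longrightarrow> n > 0 \<Longrightarrow> hd (ascent_word n \<pi>)"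
  using permutes_0[of \<pi> n] permutes_pos[of \<pi> n 1] by (simp add: ascent_word_def hd_map)

text \<open>The virtual step 0 is always an ascent, and since the letters are distinct every later
  non-ascent is a descent.\<close>

lemma des_eq_count_descents:
  assumes "\<pi> permutes {1..n}"
  shows "des n \<pi> = length (filter Not (ascent_word n \<pi>))"
proof -
  have "{i \<in> {1..<n}. \<pi> i > \<pi> (i + 1)} = {i. i < n \<and> \<not> \<pi> i < \<pi> (Suc i)}"
  proof (intro Set.set_eqI)
    fix i
    have "\<pi> i \<noteq> \<pi> (Suc i)"
      using permutes_inj[OF assms] by (metis injD n_not_Suc_n)
    moreover have "\<pi> 0 < \<pi> (Suc 0)"
      using permutes_0[OF assms] permutes_pos[OF assms] by simp
    ultimately show "i \<in> {i \<in> {1..<n}. \<pi> i > \<pi> (i + 1)} \<longleftrightarrow> i \<in> {i. i < n \<and> \<not> \<pi> i < \<pi> (Suc i)}"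
      by (cases "i = 0") auto
  qed
  moreover have "{i. i < n \<and> \<not> ascent_word n \<pi> ! i} = {i. i < n \<and> \<not> \<pi> i < \<pi> (Suc i)}"
    by (auto simp: ascent_word_def)
  ultimately show ?thesis
    by (simp add: des_def length_filter_conv_card)
qed

lemma length_remdups_adj_snoc:
  "length (remdups_adj (xs @ [x])) =
     length (remdups_adj xs) + (if xs \<noteq> [] \<and> last xs = x then 0 else 1)"
  by (induction xs rule: remdups_adj.induct) auto

text \<open>Each block is counted by its right end. The index \<open>j\<close> is one past its last
  entry, so for \<open>ascent_word\<close> it is the position of the letter which that entry leads
  to.\<close>

lemma length_remdups_adj_map_upt:
  "length (remdups_adj (map f [0..<n])) = card {j \<in> {1..n}. j = n \<or> f (j - 1) \<noteq> f j}"
proof (induction n)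
  case (Suc n)
  show ?case
  proof (cases "n = 0")
    case True
    have "{j \<in> {1..Suc 0}. j = Suc 0 \<or> f (j - 1) \<noteq> f j} = {1}" by auto
    with True show ?thesis by simp
  next
    case False
    let ?B = "{j \<in> {1..<n}. f (j - 1) \<noteq> f j}"
    have "{j \<in> {1..n}. j = n \<or> f (j - 1) \<noteq> f j} = insert n ?B"
      using False by auto
    moreover have "{j \<in> {1..Suc n}. j = Suc n \<or> f (j - 1) \<noteq> f j} =
      insert (Suc n) (if f (n - 1) \<noteq> f n then insert n ?B else ?B)"
      using False by (auto simp: less_Suc_eq_le le_less)
    moreover have "last (map f [0..<n]) = f (n - 1)"
      using False by (simp add: last_map)
    ultimately show ?thesis
      using Suc False by (auto simp: length_remdups_adj_snoc)
  qed
qed simp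

subsection \<open>Up-down runs as blocks of the word\<close>

lemma strict_mono_on_Suc_extend:
  fixes \<pi> :: "nat \<Rightarrow> nat"
  assumes "strict_mono_on {i..j} \<pi>" "\<pi> j < \<pi> (Suc j)"
  shows "strict_mono_on {i..Suc j} \<pi>"
proof (rule strict_mono_onI)
  fix r s assume *: "r \<in> {i..Suc j}" "s \<in> {i..Suc j}" "r < s"
  show "\<pi> r < \<pi> s"
  proof (cases "s = Suc j")
    case True
    then have "\<pi> r \<le> \<pi> j"
      using * strict_mono_onD[OF assms(1), of r j] by (cases "r = j") auto
    with True assms(2) show ?thesis by simp
  qed (use * strict_mono_onD[OF assms(1), of r s] in auto)
qed

lemma strict_antimono_on_Suc_extend:
  fixes \<pi> :: "nat \<Rightarrow> nat"
  assumes "strict_antimono_on {i..j} \<pi>" "\<pi> j > \<pi> (Suc j)"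
  shows "strict_antimono_on {i..Suc j} \<pi>"
proof (rule monotone_onI)
  fix r s assume *: "r \<in> {i..Suc j}" "s \<in> {i..Suc j}" "r < s"
  show "\<pi> r > \<pi> s"
  proof (cases "s = Suc j")
    case True
    then have "\<pi> r \<ge> \<pi> j"
      using * monotone_onD[OF assms(1), of r j] by (cases "r = j") auto
    with True assms(2) show ?thesis by simp
  qed (use * monotone_onD[OF assms(1), of r s] in auto)
qed

text \<open>Used to show that a monotone segment of at least two steps cannot run through a position
  where the word changes.\<close>

lemma monotone_segment_direction:
  assumes "monotone_segment n \<pi> S" "{i, Suc i, Suc (Suc i)} \<subseteq> S"
  shows "(\<pi> i < \<pi> (Suc i)) = (\<pi> (Suc i) < \<pi> (Suc (Suc i)))"
  using assms(1) unfolding monotone_segment_def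
proof (elim conjE disjE)
  assume "strict_mono_on S \<pi>"
  from strict_mono_onD[OF this] assms(2) show ?thesis by simp
next
  assume "strict_antimono_on S \<pi>"
  from monotone_onD[OF this] assms(2) show ?thesis
    by (metis insert_subset lessI less_asym)
qed

text \<open>As \<open>i < j\<close>, the segment has a last step, which fixes its direction; a next
  step in the same direction prolongs it.\<close>

lemma monotone_segment_extend:
  assumes "inj \<pi>" "monotone_segment n \<pi> {i..j}" "i < j" "j < n"
    and "(\<pi> (j - 1) < \<pi> j) = (\<pi> j < \<pi> (Suc j))"
  shows "monotone_segment n \<pi> {i..Suc j}"
proof -
  have seg: "segment n {i..Suc j}"
    using assms(2-4) by (auto simp: monotone_segment_def segment_def)
  have neq: "\<pi> j \<noteq> \<pi> (Suc j)"
    using injD[OF assms(1)] by fastforce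
  consider "strict_mono_on {i..j} \<pi>" | "strict_antimono_on {i..j} \<pi>"
    using assms(2) by (auto simp: monotone_segment_def)
  then show ?thesis
  proof cases
    case 1
    then have "\<pi> (j - 1) < \<pi> j"
      using assms(3) by (auto dest: strict_mono_onD[of _ _ "j - 1" j])
    with 1 assms(5) show ?thesis
      using strict_mono_on_Suc_extend seg by (simp add: monotone_segment_def)
  next
    case 2
    then have "\<pi> (j - 1) > \<pi> j"
      using assms(3) by (auto dest: monotone_onD[of _ _ _ _ "j - 1" j])
    with 2 assms(5) neq show ?thesis
      using strict_antimono_on_Suc_extend seg by (simp add: monotone_segment_def)
  qed
qed

lemma Max_atLeastAtMost: "i \<le> j \<Longrightarrow> Max {i..j} = (j::nat)"
  by (rule Max_eqI) auto

lemma birun_Max_inj: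
  assumes "birun n \<pi> S" "birun n \<pi> T" "Max S = Max T"
  shows "S = T"
proof -
  obtain i j i' j' where *: "S = {i..j}" "i \<le> j" "T = {i'..j'}" "i' \<le> j'"
    using assms(1,2) by (auto simp: birun_def monotone_segment_def segment_def)
  with assms(3) have "j = j'" by (simp add: Max_atLeastAtMost)
  with * have "S \<subseteq> T \<or> T \<subseteq> S" by auto
  with assms(1,2) show ?thesis by (auto simp: birun_def)
qed

text \<open>A segment containing position 1 starts there, so the step from 1 to 2 decides. As the
  virtual step is an ascent, the condition says that a block of the word ends at position 1.\<close>

lemma singleton_1_increasing_run_iff:
  assumes "\<pi> permutes {1..n}" "n \<ge> 1"
  shows "increasing_run n \<pi> {1} \<longleftrightarrow> n = 1 \<or> \<not> \<pi> 1 < \<pi> 2"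
proof
  assume run: "increasing_run n \<pi> {1}"
  show "n = 1 \<or> \<not> \<pi> 1 < \<pi> 2"
  proof (rule ccontr)
    assume "\<not> ?thesis"
    then have "increasing_segment n \<pi> {1..2}"
      using assms(2) strict_mono_on_Suc_extend[of 1 1 \<pi>]
      by (auto simp: increasing_segment_def segment_def numeral_2_eq_2 ord.strict_mono_on_def)
    with run have "{1..2::nat} = {1}" by (auto simp: increasing_run_def)
    then have "(2::nat) \<in> {1}" by auto
    then show False by simp
  qed
next
  assume *: "n = 1 \<or> \<not> \<pi> 1 < \<pi> 2"
  show "increasing_run n \<pi> {1}"
    unfolding increasing_run_def
  proof (intro conjI allI impI)
    show "increasing_segment n \<pi> {1}"
      using assms(2) by (auto simp: increasing_segment_def segment_def intro!: exI[of _ 1] strict_mono_onI)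
  next
    fix T assume T: "increasing_segment n \<pi> T \<and> {1} \<subseteq> T"
    then obtain i j where ij: "1 \<le> i" "i \<le> j" "j \<le> n" "T = {i..j}"
      by (auto simp: increasing_segment_def segment_def)
    with T have "i = 1" by auto
    moreover have "j = 1"
    proof (rule ccontr)
      assume "j \<noteq> 1"
      with ij \<open>i = 1\<close> have "{1, 2} \<subseteq> T" "n \<noteq> 1" by auto
      with T * show False
        by (auto simp: increasing_segment_def dest: strict_mono_onD[of _ _ 1 2])
    qed
    ultimately show "T = {1}" using ij by simp
  qed
qed

text \<open>Two maximal segments with the same right end are nested, so an up-down run is determined by
  its right end, and these right ends are \<open>n\<close> and the positions where the word changes.\<close>

lemma birun_Max_turning:
  assumes "inj \<pi>" "birun n \<pi> S"
  shows "2 \<le> Max S \<and> Max S \<le> n \<and>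
    (Max S = n \<or> (\<pi> (Max S - 1) < \<pi> (Max S)) \<noteq> (\<pi> (Max S) < \<pi> (Suc (Max S))))"
proof -
  obtain i j where ij: "1 \<le> i" "i \<le> j" "j \<le> n" "S = {i..j}"
    using assms(2) by (auto simp: birun_def monotone_segment_def segment_def)
  moreover from ij have "i < j"
    using assms(2) by (auto simp: birun_def)
  moreover have "j = n \<or> (\<pi> (j - 1) < \<pi> j) \<noteq> (\<pi> j < \<pi> (Suc j))"
  proof (rule ccontr)
    assume "\<not> ?thesis"
    then have "monotone_segment n \<pi> {i..Suc j}"
      using monotone_segment_extend[of \<pi> n i j] assms ij \<open>i < j\<close> by (simp add: birun_def)
    moreover have "S \<subseteq> {i..Suc j}"
      using ij(4) by auto
    ultimately have "{i..Suc j} = S"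
      using assms(2) by (simp add: birun_def)
    then have "Suc j \<in> {i..j}"
      using ij by auto
    then show False by simp
  qed
  ultimately show ?thesis by (simp add: Max_atLeastAtMost)
qed

text \<open>The longest monotone segment with right end \<open>j\<close> works: minimality of
  \<open>i\<close> prevents growth to the left, the change of direction at \<open>j\<close> (or the
  end of the word) prevents growth to the right.\<close>

lemma ex_birun_Max:
  assumes "inj \<pi>" "2 \<le> j" "j \<le> n"
    and turn: "j = n \<or> (\<pi> (j - 1) < \<pi> j) \<noteq> (\<pi> j < \<pi> (Suc j))"
  shows "\<exists>S. birun n \<pi> S \<and> Max S = j"
proof -
  define P where "P = (\<lambda>i. 1 \<le> i \<and> i \<le> j \<and> monotone_segment n \<pi> {i..j})"
  have "P (j - 1)"
  proof -
    have "{j - 1..j} = {j - 1, j}" "\<pi> (j - 1) \<noteq> \<pi> j"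
      using assms(2) injD[OF assms(1), of "j - 1" j] by auto
    then have "strict_mono_on {j - 1..j} \<pi> \<or> strict_antimono_on {j - 1..j} \<pi>"
      using assms(2) by (auto simp: monotone_on_def)
    then show ?thesis
      using assms(2,3) by (auto simp: P_def monotone_segment_def segment_def)
  qed
  define i where "i = (LEAST i. P i)"
  have "P i" and "i \<le> j - 1"
    using \<open>P (j - 1)\<close> by (auto simp: i_def intro: LeastI Least_le)
  have "T = {i..j}" if T: "monotone_segment n \<pi> T" "{i..j} \<subseteq> T" for T
  proof -
    obtain a b where ab: "1 \<le> a" "a \<le> b" "b \<le> n" "T = {a..b}"
      using T(1) by (auto simp: monotone_segment_def segment_def)
    have "a \<le> i" "j \<le> b"
      using T(2) ab(4) \<open>i \<le> j - 1\<close> assms(2) by auto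
    have "b = j"
    proof (rule ccontr)
      assume "b \<noteq> j"
      then have "{j - 1, Suc (j - 1), Suc (Suc (j - 1))} \<subseteq> T" "j \<noteq> n"
        using ab \<open>a \<le> i\<close> \<open>j \<le> b\<close> \<open>i \<le> j - 1\<close> assms(2) by auto
      from monotone_segment_direction[OF T(1) this(1)] this(2) turn assms(2)
      show False by auto
    qed
    then have "P a"
      using ab T(1) by (simp add: P_def)
    then have "i \<le> a"
      by (simp add: i_def Least_le)
    with \<open>a \<le> i\<close> \<open>b = j\<close> ab(4) show ?thesis by simp
  qed
  then have "birun n \<pi> {i..j}"
    using \<open>P i\<close> \<open>i \<le> j - 1\<close> assms(2) by (auto simp: birun_def P_def)
  moreover have "Max {i..j} = j"
    using \<open>i \<le> j - 1\<close> by (simp add: Max_atLeastAtMost)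
  ultimately show ?thesis by blast
qed

lemma udr_eq_blocks:
  assumes "\<pi> permutes {1..n}" "n \<ge> 1"
  shows "udr n \<pi> = length (remdups_adj (ascent_word n \<pi>))"
proof -
  let ?up = "\<lambda>i. \<pi> i < \<pi> (Suc i)"
  let ?E = "{j \<in> {1..n}. j = n \<or> ?up (j - 1) \<noteq> ?up j}"
  have inj: "inj \<pi>" by (rule permutes_inj[OF assms(1)])
  have 1: "1 \<in> ?E \<longleftrightarrow> increasing_run n \<pi> {1}"
    using singleton_1_increasing_run_iff[OF assms] assms(2)
      permutes_0[OF assms(1)] permutes_pos[OF assms(1), of 1]
    by (auto simp: numeral_2_eq_2)
  have turning: "j \<in> ?E \<longleftrightarrow> j \<le> n \<and> (j = n \<or> (\<pi> (j - 1) < \<pi> j) \<noteq> (\<pi> j < \<pi> (Suc j)))"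
    if "2 \<le> j" for j
    using that by auto
  have "bij_betw Max {S. up_down_run n \<pi> S} ?E"
  proof (rule bij_betw_imageI)
    show "inj_on Max {S. up_down_run n \<pi> S}"
    proof (rule inj_onI)
      fix S T assume "S \<in> {S. up_down_run n \<pi> S}" "T \<in> {S. up_down_run n \<pi> S}" "Max S = Max T"
      \<comment> \<open>A birun ends at position 2 or later, so it never shares its right end with
        \<open>{1}\<close>.\<close>
      then show "S = T"
        using birun_Max_inj[of n \<pi> S T] birun_Max_turning[OF inj, of n]
        by (fastforce simp: up_down_run_def)
    qed
    show "Max ` {S. up_down_run n \<pi> S} = ?E"
    proof (intro Set.set_eqI iffI)
      fix j assume "j \<in> Max ` {S. up_down_run n \<pi> S}"
      then obtain S where S: "up_down_run n \<pi> S" "j = Max S" by blast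
      show "j \<in> ?E"
      proof (cases "birun n \<pi> S")
        case True
        with birun_Max_turning[OF inj this] S turning show ?thesis by blast
      next
        case False
        with S have "j = 1" "increasing_run n \<pi> {1}" by (auto simp: up_down_run_def)
        with 1 show ?thesis by blast
      qed
    next
      fix j assume j: "j \<in> ?E"
      show "j \<in> Max ` {S. up_down_run n \<pi> S}"
      proof (cases "j = 1")
        case True
        with j 1 have "increasing_run n \<pi> {1}" by blast
        then have "up_down_run n \<pi> {1}" "Max {1} = j"
          using True by (auto simp: up_down_run_def)
        then show ?thesis by blast
      next
        case False
        with j have "2 \<le> j" by auto
        with j turning ex_birun_Max[OF inj this] obtain S where "birun n \<pi> S" "Max S = j"
          by blast
        then show ?thesis by (auto simp: up_down_run_def)
      qed
    qed
  qed
  then show ?thesis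
    unfolding udr_def ascent_word_def length_remdups_adj_map_upt by (rule bij_betw_same_card)
qed

subsection \<open>Inserting a new maximum\<close>

text \<open>The words obtained by inserting a new largest letter in all possible places: inside a step
  it replaces that step by an ascent and a descent, at the end it appends an ascent.\<close>

fun insertions :: "bool list \<Rightarrow> bool list list" where
  "insertions [] = [[True]]"
| "insertions (x # w) = (True # False # w) # map ((#) x) (insertions w)"

text \<open>Links the recursive form, suited to induction on the word, with sums over the insertion
  place: \<open>j\<close> is the step that is split, and \<open>j = length w\<close>
  appends.\<close>

lemma insertions_eq_map:
  "insertions w = map (\<lambda>j. take j w @ True # (if j < length w then False # drop (Suc j) w else []))
     [0..<Suc (length w)]"
proof (induction w)
  case (Cons x w)
  show ?case
    unfolding insertions.simps Cons
    by (subst upt_conv_Cons)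
      (auto simp: map_Suc_upt[symmetric] simp del: upt_Suc)
qed simp

text \<open>For a permutation \<open>\<pi>\<close> of \<open>[n]\<close>, which fixes
  \<open>Suc n\<close>, the composite \<open>\<pi> \<circ> shift_cycle n k\<close> is
  \<open>\<pi>\<close> with the letter \<open>Suc n\<close> inserted at position
  \<open>k\<close>.\<close>

definition shift_cycle :: "nat \<Rightarrow> nat \<Rightarrow> nat \<Rightarrow> nat" where
  "shift_cycle n k i =
     (if i < k then i else if i = k then Suc n else if i \<le> Suc n then i - 1 else i)"

lemma shift_cycle_permutes:
  assumes "1 \<le> k" "k \<le> Suc n"
  shows "shift_cycle n k permutes {1..Suc n}"
  by (rule inj_imp_permutes)
    (use assms in \<open>auto simp: shift_cycle_def inj_on_def split: if_splits\<close>)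

lemma ascent_word_insert:
  assumes "\<pi> permutes {1..n}" "j \<le> n"
  shows "ascent_word (Suc n) (\<pi> \<circ> shift_cycle n (Suc j)) =
    take j (ascent_word n \<pi>) @ True #
      (if j < n then False # drop (Suc j) (ascent_word n \<pi>) else [])" (is "?l = ?r")
proof (rule nth_equalityI)
  show "length ?l = length ?r"
    using assms(2) by auto
  fix i assume "i < length ?l"
  then have i: "i \<le> n" by simp
  have max: "\<pi> (Suc n) = Suc n"
    by (rule permutes_not_in[OF assms(1)]) auto
  consider "i < j" | "i = j" | "i = Suc j" | "i > Suc j" by linarith
  then show "?l ! i = ?r ! i"
  proof cases
    case 1
    with i assms(2) show ?thesis
      by (simp add: ascent_word_def nth_append shift_cycle_def del: upt_Suc)
  next
    case 2
    with i permutes_le[OF assms] show ?thesis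
      by (simp add: ascent_word_def nth_append shift_cycle_def max less_Suc_eq_le del: upt_Suc)
  next
    case 3
    with i permutes_le[OF assms(1), of "Suc j"] show ?thesis
      by (simp add: ascent_word_def nth_append shift_cycle_def max del: upt_Suc)
  next
    case 4
    then obtain d where "i = Suc (Suc (j + d))"
      using that[of "i - Suc (Suc j)"] by simp
    with i show ?thesis
      by (simp add: ascent_word_def nth_append shift_cycle_def del: upt_Suc)
  qed
qed

text \<open>The position of the largest letter determines \<open>k\<close>, and cancelling the cycle
  recovers \<open>\<pi>\<close>. Surjectivity follows by counting.\<close>

lemma bij_betw_insert_max:
  "bij_betw (\<lambda>(\<pi>, k). \<pi> \<circ> shift_cycle n k)
     ({\<pi>. \<pi> permutes {1..n}} \<times> {1..Suc n}) {\<pi>. \<pi> permutes {1..Suc n}}"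
proof -
  let ?f = "\<lambda>(\<pi>, k). \<pi> \<circ> shift_cycle n k"
  let ?A = "{\<pi>. \<pi> permutes {1..n}} \<times> {1..Suc n}"
  have inj: "inj_on ?f ?A"
  proof (intro inj_onI, clarsimp)
    fix \<pi> \<sigma> k l
    assume p: "\<pi> permutes {Suc 0..n}" "\<sigma> permutes {Suc 0..n}"
      and kl: "Suc 0 \<le> k" "k \<le> Suc n" "Suc 0 \<le> l" "l \<le> Suc n"
      and eq: "\<pi> \<circ> shift_cycle n k = \<sigma> \<circ> shift_cycle n l"
    have max: "\<pi> (Suc n) = Suc n" "\<sigma> (Suc n) = Suc n"
      by (rule permutes_not_in[OF p(1)], simp) (rule permutes_not_in[OF p(2)], simp)
    \<comment> \<open>Both sides equal \<open>Suc n\<close>: the left one by evaluating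
      \<open>eq\<close> at \<open>k\<close>.\<close>
    have "\<sigma> (shift_cycle n l k) = \<sigma> (shift_cycle n l l)"
      using fun_cong[OF eq, of k] max by (simp add: shift_cycle_def)
    then have "k = l"
      using permutes_inj[OF p(2)] permutes_inj[OF shift_cycle_permutes[of l n]] kl
      by (auto dest!: injD)
    moreover have "surj (shift_cycle n l)"
      using permutes_surj[OF shift_cycle_permutes[of l n]] kl by simp
    ultimately show "\<pi> = \<sigma> \<and> k = l"
      using eq by (metis surj_fun_eq)
  qed
  have sub: "?f ` ?A \<subseteq> {\<pi>. \<pi> permutes {1..Suc n}}"
    by (auto intro!: permutes_compose shift_cycle_permutes[simplified]
        intro: permutes_subset)
  have "card (?f ` ?A) = card ?A"
    by (rule card_image[OF inj])
  also have "\<dots> = card {\<pi>. \<pi> permutes {1..Suc n}}"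
    by (simp add: card_cartesian_product card_permutations[OF refl] card_permutations[of _ "Suc n"])
  finally have "?f ` ?A = {\<pi>. \<pi> permutes {1..Suc n}}"
    using sub by (intro card_subset_eq) (auto simp: finite_permutations)
  with inj show ?thesis by (simp add: bij_betw_def)
qed

lemma sum_permutes_Suc:
  fixes F :: "bool list \<Rightarrow> 'a :: comm_monoid_add"
  shows "(\<Sum>\<pi> | \<pi> permutes {1..Suc n}. F (ascent_word (Suc n) \<pi>)) =
    (\<Sum>\<pi> | \<pi> permutes {1..n}. sum_list (map F (insertions (ascent_word n \<pi>))))"
proof -
  have "(\<Sum>\<pi> | \<pi> permutes {1..Suc n}. F (ascent_word (Suc n) \<pi>)) =
      (\<Sum>x\<in>{\<pi>. \<pi> permutes {1..n}} \<times> {1..Suc n}.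
        F (ascent_word (Suc n) (case x of (\<pi>, k) \<Rightarrow> \<pi> \<circ> shift_cycle n k)))"
    by (rule sum.reindex_bij_betw[OF bij_betw_insert_max, symmetric])
  also have "\<dots> = (\<Sum>\<pi> | \<pi> permutes {1..n}. \<Sum>k\<in>{1..Suc n}. F (ascent_word (Suc n) (\<pi> \<circ> shift_cycle n k)))"
    by (simp add: sum.cartesian_product case_prod_unfold del: sum.cl_ivl_Suc)
  also have "\<dots> = (\<Sum>\<pi> | \<pi> permutes {1..n}. sum_list (map F (insertions (ascent_word n \<pi>))))"
  proof (rule sum.cong[OF refl], clarsimp simp del: sum.cl_ivl_Suc)
    fix \<pi> assume p: "\<pi> permutes {Suc 0..n}"
    have "(\<Sum>k\<in>{Suc 0..Suc n}. F (ascent_word (Suc n) (\<pi> \<circ> shift_cycle n k))) =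
        (\<Sum>j\<in>{0..n}. F (ascent_word (Suc n) (\<pi> \<circ> shift_cycle n (Suc j))))"
      by (rule sum.shift_bounds_cl_Suc_ivl)
    also have "\<dots> = (\<Sum>j\<in>{0..<Suc n}. F (take j (ascent_word n \<pi>) @ True #
        (if j < n then False # drop (Suc j) (ascent_word n \<pi>) else [])))"
      using p by (intro sum.cong) (auto simp: ascent_word_insert)
    also have "\<dots> = sum_list (map F (insertions (ascent_word n \<pi>)))"
      by (simp add: insertions_eq_map o_def interv_sum_list_conv_sum_set_nat del: upt_Suc)
    finally show "(\<Sum>k\<in>{Suc 0..Suc n}. F (ascent_word (Suc n) (\<pi> \<circ> shift_cycle n k))) =
      sum_list (map F (insertions (ascent_word n \<pi>)))" .
  qed
  finally show ?thesis .
qed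

text \<open>Splitting a descent or appending at the end keeps the number of descents; splitting an
  ascent raises it by 1.\<close>

lemma sum_insertions_descents:
  fixes t :: "'a :: comm_ring_1"
  shows "(\<Sum>w'\<leftarrow>insertions w. t ^ length (filter Not w')) =
    of_nat (length (filter Not w) + 1) * t ^ length (filter Not w)
    + (of_nat (length w) - of_nat (length (filter Not w))) * t ^ (length (filter Not w) + 1)"
proof (induction w)
  case (Cons x w)
  show ?case
    by (cases x) (simp_all add: o_def sum_list_const_mult Cons.IH, simp_all add: algebra_simps)
qed simp

text \<open>The letter \<open>p\<close> in front, which is never split, makes the induction work,
  since the block count depends on the preceding letter. The pair \<open>c\<close> counts the
  insertions that add 0 and 1 blocks; all others add 2.\<close>

lemma sum_insertions_blocks_Cons:
  fixes t :: "'a :: comm_ring_1"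
  shows "(\<Sum>w'\<leftarrow>insertions w. t ^ length (remdups_adj (p # w'))) =
    (let r = length (remdups_adj (p # w)); n = length w;
         c = (if \<not> p then (of_nat r - 1, 1) else if w = [] then (1, 0)
              else if hd w then (of_nat r, 1) else (of_nat r - 1, 1))
     in fst c * t ^ r + snd c * t ^ (r + 1) + (of_nat n + 1 - fst c - snd c) * t ^ (r + 2))"
proof (induction w arbitrary: p)
  case Nil
  show ?case by (cases p) auto
next
  case (Cons x w)
  \<comment> \<open>Either \<open>x\<close> itself is split, or the insertion happens after it; then
    \<open>p\<close> contributes a block of its own exactly when it differs from
    \<open>x\<close>.\<close>
  have "(\<Sum>w'\<leftarrow>insertions (x # w). t ^ length (remdups_adj (p # w'))) =
    t ^ length (remdups_adj (p # True # False # w)) +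
    (if p = x then 1 else t) * (\<Sum>w'\<leftarrow>insertions w. t ^ length (remdups_adj (x # w')))"
    by (simp add: o_def sum_list_const_mult)
  then show ?case
    unfolding Cons.IH
    by (cases p; cases x; cases w; cases "hd w") (auto simp: Let_def algebra_simps)
qed

text \<open>The count is kept by splitting the last ascent before a descent or the first descent
  after an ascent, as the new letters join the neighbouring blocks. For even \<open>r\<close> these
  are \<open>r\<close> places, and appending adds 1. For odd \<open>r\<close> they are
  \<open>r - 1\<close>; appending is the last neutral place and splitting the final ascent adds
  1.\<close>

lemma sum_insertions_blocks:
  fixes t :: "'a :: comm_ring_1"
  assumes "w \<noteq> []" "hd w"
  defines "r \<equiv> length (remdups_adj w)"
  shows "(\<Sum>w'\<leftarrow>insertions w. t ^ length (remdups_adj w')) =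
    of_nat r * t ^ r + t ^ (r + 1) + (of_nat (length w) - of_nat r) * t ^ (r + 2)"
proof -
  obtain v where w: "w = True # v"
    using assms by (cases w) auto
  show ?thesis
    using sum_insertions_blocks_Cons[of t True v]
    by (cases v; cases "hd v") (auto simp: w r_def o_def Let_def algebra_simps)
qed

subsection \<open>Recurrences\<close>

text \<open>Turns the factors \<open>of_nat r\<close> in the insertion counts into derivatives of
  the generating polynomials.\<close>

lemma fps_X_times_deriv_power:
  "fps_X * fps_deriv (fps_X ^ r :: real fps) = of_nat r * fps_X ^ r"
  by (cases r, simp, subst fps_deriv_power') (simp add: mult_ac)

lemma fps_of_eulerian_poly:
  "fps_of_poly (eulerian_poly n) =
    (\<Sum>\<pi> | \<pi> permutes {1..n}. fps_X ^ (length (filter Not (ascent_word n \<pi>)) + 1))"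
  unfolding eulerian_poly_def fps_of_poly_sum fps_of_poly_monom'
  by (rule sum.cong[OF refl]) (simp only: mem_Collect_eq des_eq_count_descents)

lemma fps_of_udr_poly:
  assumes "n \<ge> 1"
  shows "fps_of_poly (udr_poly n) =
    (\<Sum>\<pi> | \<pi> permutes {1..n}. fps_X ^ length (remdups_adj (ascent_word n \<pi>)))"
  unfolding udr_poly_def fps_of_poly_sum fps_of_poly_monom'
  by (rule sum.cong[OF refl]) (simp only: mem_Collect_eq udr_eq_blocks[OF _ assms])

lemma eulerian_poly_Suc:
  fixes n defines "A \<equiv> fps_of_poly (eulerian_poly n)"
  shows "fps_of_poly (eulerian_poly (Suc n)) =
    of_nat (Suc n) * fps_X * A + fps_X * (1 - fps_X) * fps_deriv A"
proof -
  let ?P = "{\<pi>. \<pi> permutes {1..n}}"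
  let ?d = "\<lambda>\<pi>. length (filter Not (ascent_word n \<pi>))"
  let ?X = "fps_X :: real fps"
  have "fps_of_poly (eulerian_poly (Suc n)) =
    (\<Sum>\<pi>\<in>?P. \<Sum>w\<leftarrow>insertions (ascent_word n \<pi>). ?X ^ (length (filter Not w) + 1))"
    unfolding fps_of_eulerian_poly by (rule sum_permutes_Suc)
  also have "\<dots> = (\<Sum>\<pi>\<in>?P. ?X * (of_nat (?d \<pi> + 1) * ?X ^ ?d \<pi>
       + (of_nat n - of_nat (?d \<pi>)) * ?X ^ (?d \<pi> + 1)))"
    using sum_insertions_descents[of ?X] by (simp add: sum_list_const_mult)
  \<comment> \<open>The exponent is \<open>d + 1\<close>, so \<open>n - d\<close> is written as
    \<open>(n + 1) - (d + 1)\<close>.\<close>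
  also have "\<dots> = (\<Sum>\<pi>\<in>?P. of_nat (Suc n) * ?X * ?X ^ (?d \<pi> + 1)
       + (1 - ?X) * (?X * fps_deriv (?X ^ (?d \<pi> + 1))))"
    unfolding fps_X_times_deriv_power by (simp add: algebra_simps)
  also have "\<dots> = of_nat (Suc n) * ?X * A + (1 - ?X) * (?X * fps_deriv A)"
    unfolding A_def fps_of_eulerian_poly fps_deriv_sum sum_distrib_left sum.distrib ..
  finally show ?thesis by (simp add: mult_ac)
qed

lemma udr_poly_Suc:
  fixes n defines "P \<equiv> fps_of_poly (udr_poly n)"
  assumes "n \<ge> 1"
  shows "fps_of_poly (udr_poly (Suc n)) =
    fps_X * (1 - fps_X ^ 2) * fps_deriv P + (fps_X + of_nat n * fps_X ^ 2) * P"
proof -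
  let ?S = "{\<pi>. \<pi> permutes {1..n}}"
  let ?r = "\<lambda>\<pi>. length (remdups_adj (ascent_word n \<pi>))"
  let ?X = "fps_X :: real fps"
  have "fps_of_poly (udr_poly (Suc n)) =
    (\<Sum>\<pi>\<in>?S. \<Sum>w\<leftarrow>insertions (ascent_word n \<pi>). ?X ^ length (remdups_adj w))"
    unfolding fps_of_udr_poly[OF le_SucI[OF assms(2)]] by (rule sum_permutes_Suc)
  also have "\<dots> = (\<Sum>\<pi>\<in>?S. of_nat (?r \<pi>) * ?X ^ ?r \<pi> + ?X ^ (?r \<pi> + 1)
       + (of_nat n - of_nat (?r \<pi>)) * ?X ^ (?r \<pi> + 2))"
  proof (rule sum.cong[OF refl])
    fix \<pi> assume "\<pi> \<in> ?S"
    then have "ascent_word n \<pi> \<noteq> []" "hd (ascent_word n \<pi>)"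
      using assms(2) hd_ascent_word[of \<pi> n] by (auto simp: ascent_word_def)
    from sum_insertions_blocks[OF this, of ?X]
    show "(\<Sum>w\<leftarrow>insertions (ascent_word n \<pi>). ?X ^ length (remdups_adj w)) =
      of_nat (?r \<pi>) * ?X ^ ?r \<pi> + ?X ^ (?r \<pi> + 1)
       + (of_nat n - of_nat (?r \<pi>)) * ?X ^ (?r \<pi> + 2)" by simp
  qed
  also have "\<dots> = (\<Sum>\<pi>\<in>?S. (1 - ?X ^ 2) * (?X * fps_deriv (?X ^ ?r \<pi>))
       + (?X + of_nat n * ?X ^ 2) * ?X ^ ?r \<pi>)"
    unfolding fps_X_times_deriv_power by (simp add: algebra_simps power2_eq_square)
  also have "\<dots> = (1 - ?X ^ 2) * (?X * fps_deriv P) + (?X + of_nat n * ?X ^ 2) * P"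
    unfolding P_def fps_of_udr_poly[OF assms(2)] fps_deriv_sum sum_distrib_left sum.distrib ..
  finally show ?thesis by (simp add: mult_ac)
qed

subsection \<open>The substitution\<close>

definition u_series :: "real fps" where
  "u_series = 2 * fps_X / (1 + fps_X ^ 2)"

lemma u_series_mult: "u_series * (1 + fps_X ^ 2) = 2 * fps_X"
  unfolding u_series_def
  by (subst fps_divide_unit) (simp_all add: mult.assoc inverse_mult_eq_1)

lemma u_series_nth_0: "fps_nth u_series 0 = 0"
  using arg_cong[OF u_series_mult, of "\<lambda>f. fps_nth f 0"] by simp

lemma u_series_deriv: "fps_deriv u_series * (1 + fps_X ^ 2) ^ 2 = 2 * (1 - fps_X ^ 2)"
proof -
  have "fps_deriv (u_series * (1 + fps_X ^ 2)) = fps_deriv (2 * fps_X)"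
    by (simp add: u_series_mult)
  then have "fps_deriv u_series * (1 + fps_X ^ 2) + u_series * (2 * fps_X) = 2"
    by (simp add: fps_deriv_power' algebra_simps)
  with u_series_mult show ?thesis by algebra
qed

lemma eulerian_poly_eq_udr_poly_compose:
  "(1 + fps_X ^ 2) ^ Suc m * (fps_of_poly (udr_poly (Suc m)) oo u_series) =
     2 * (1 + fps_X) ^ m * fps_of_poly (eulerian_poly (Suc m))"
proof (induction m)
  case 0
  have "fps_of_poly (eulerian_poly (Suc 0)) = fps_X"
    unfolding fps_of_eulerian_poly by (simp add: ascent_word_def)
  moreover have "fps_of_poly (udr_poly (Suc 0)) = fps_X"
    by (subst fps_of_udr_poly) (simp_all add: ascent_word_def)
  ultimately show ?case
    using u_series_mult by (simp add: u_series_nth_0 mult.commute)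
next
  case (Suc m)
  define D where "D = (1 + fps_X ^ 2 :: real fps)"
  define u where "u = u_series"
  define q where "q = fps_of_poly (udr_poly (Suc m)) oo u"
  define p' where "p' = fps_deriv (fps_of_poly (udr_poly (Suc m))) oo u"
  define a where "a = fps_of_poly (eulerian_poly (Suc m))"
  define N where "N = (of_nat (Suc m) :: real fps)"
  define E where "E = D ^ Suc m * q"
  let ?X = "fps_X :: real fps"
  have u: "u * D = 2 * ?X" and u': "fps_deriv u * D ^ 2 = 2 * (1 - ?X ^ 2)"
    and u0: "fps_nth u 0 = 0"
    unfolding u_def D_def by (fact u_series_mult u_series_deriv u_series_nth_0)+
  have "D \<noteq> 0"
    using arg_cong[of D 0 "\<lambda>f. fps_nth f 0"] by (auto simp: D_def)
  have IH: "E = 2 * (1 + ?X) ^ m * a"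
    using Suc by (simp add: E_def D_def q_def u_def a_def)
  have q': "fps_deriv q = p' * fps_deriv u"
    unfolding q_def p'_def using u0 by (rule fps_compose_deriv)
  have of_nat: "(of_nat k :: real fps) oo u = of_nat k" for k
    by (metis fps_const_compose fps_of_nat)
  have q2: "fps_of_poly (udr_poly (Suc (Suc m))) oo u = u * (1 - u ^ 2) * p' + (u + N * u ^ 2) * q"
    using u0 unfolding q_def p'_def N_def
    by (simp add: udr_poly_Suc of_nat fps_compose_add_distrib fps_compose_sub_distrib
        fps_compose_mult_distrib fps_compose_power[symmetric])
  have E': "fps_deriv E = D ^ m * (2 * N * ?X * q + D * (p' * fps_deriv u))"
  proof -
    have "fps_deriv D = 2 * ?X"
      by (simp add: D_def fps_deriv_power')
    then have "fps_deriv (D ^ Suc m) = N * (2 * ?X) * D ^ m"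
      unfolding fps_deriv_power' N_def by simp
    then show ?thesis
      unfolding E_def fps_deriv_mult q' by (simp add: algebra_simps)
  qed
  \<comment> \<open>The recurrence for \<open>udr_poly\<close>, composed with \<open>u\<close> and
    cleared of denominators, becomes the recurrence for \<open>E\<close>. Facts 1 and 2 match the
    coefficients of \<open>p'\<close>, facts 3 and 4 those of \<open>q\<close>.\<close>
  have "D ^ 2 * (u * (1 - u ^ 2) * p' + (u + N * u ^ 2) * q) =
    ?X * (1 - ?X ^ 2) * (2 * N * ?X * q + D * (p' * fps_deriv u)) + 2 * ?X * (1 + N * ?X) * D * q"
  proof -
    have 1: "D ^ 2 * (1 - u ^ 2) = (1 - ?X ^ 2) ^ 2"
      using u unfolding D_def by algebra
    have "2 * (u * (1 - ?X ^ 2) ^ 2) = 2 * (?X * (1 - ?X ^ 2) * D * fps_deriv u)"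
      using u u' by algebra
    then have 2: "u * (1 - ?X ^ 2) ^ 2 = ?X * (1 - ?X ^ 2) * D * fps_deriv u"
      by simp
    have 3: "D ^ 2 * (u + N * u ^ 2) = 2 * ?X * D + 4 * N * ?X ^ 2"
      using u by algebra
    have 4: "4 * N * ?X ^ 2 = ?X * (1 - ?X ^ 2) * (2 * N * ?X) + 2 * ?X * (N * ?X) * D"
      unfolding D_def by algebra
    show ?thesis using 1 2 3 4 by algebra
  qed
  then have "D ^ m * (D ^ 2 * (u * (1 - u ^ 2) * p' + (u + N * u ^ 2) * q)) = D ^ m *
    (?X * (1 - ?X ^ 2) * (2 * N * ?X * q + D * (p' * fps_deriv u)) + 2 * ?X * (1 + N * ?X) * D * q)"
    by simp
  also have "\<dots> =
    ?X * (1 - ?X ^ 2) * fps_deriv E + 2 * ?X * (1 + N * ?X) * E"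
    unfolding E' by (simp add: E_def algebra_simps)
  \<comment> \<open>Now \<open>E\<close> is replaced by its Eulerian form. The coefficients of
    \<open>a\<close> combine through
    \<open>(1 - X) * (N - 1) + 2 * (1 + N * X) = (N + 1) * (1 + X)\<close>.\<close>
  also have "\<dots> = 2 * (1 + ?X) ^ Suc m *
    (of_nat (Suc (Suc m)) * ?X * a + ?X * (1 - ?X) * fps_deriv a)"
  proof -
    define Z where "Z = (1 + ?X) ^ m"
    define Z' where "Z' = fps_deriv Z"
    have Z': "(1 + ?X) * Z' = (N - 1) * Z"
      unfolding Z'_def Z_def N_def fps_deriv_power' by (cases m) (simp_all add: mult_ac)
    have E: "E = 2 * Z * a" "fps_deriv E = 2 * (Z' * a + Z * fps_deriv a)"
      unfolding IH Z_def[symmetric] Z'_def by (simp_all add: algebra_simps)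
    have N: "of_nat (Suc (Suc m)) = N + 1"
      by (simp add: N_def)
    show ?thesis
      unfolding E(2) N power_Suc Z_def[symmetric] unfolding E(1) using Z' by algebra
  qed
  also have "\<dots> = 2 * (1 + ?X) ^ Suc m * fps_of_poly (eulerian_poly (Suc (Suc m)))"
    unfolding eulerian_poly_Suc[of "Suc m"] a_def ..
  finally show ?case
    unfolding D_def[symmetric] u_def[symmetric] q2 by (simp add: power2_eq_square mult_ac)
qed

section \<open>Inverting the substitution and deriving both identities\<close>

lemma u_series_compose_v_series: "u_series oo v_series = fps_X"
proof -
  note v0 = v_series_nth_0
  \<comment> \<open>Squaring the square root shows that v solves
    \<open>X * (1 + v ^ 2) = 2 * v\<close>, which is the equation \<open>u(v) = X\<close> without
    denominators.\<close>
  have "(1 - fps_X * v_series) ^ 2 = 1 - fps_X ^ 2"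
    using sqrt_one_minus_X2_iff[of sqrt_one_minus_X2] by (simp add: X_times_v_series)
  then have "fps_X * (fps_X * (1 + v_series ^ 2)) = fps_X * (2 * v_series)"
    by algebra
  then have v: "fps_X * (1 + v_series ^ 2) = 2 * v_series"
    by simp
  have "(u_series * (1 + fps_X ^ 2)) oo v_series = (2 * fps_X) oo v_series"
    by (simp add: u_series_mult)
  then have "(u_series oo v_series) * (1 + v_series ^ 2) = 2 * v_series"
    using v0 by (simp add: fps_compose_mult_distrib fps_compose_add_distrib fps_compose_power[symmetric])
  then have "(u_series oo v_series) * (1 + v_series ^ 2) = fps_X * (1 + v_series ^ 2)"
    using v by simp
  moreover have "fps_nth (1 + v_series ^ 2) 0 = 1"
    using v0 by (simp add: power2_eq_square)
  then have "1 + v_series ^ 2 \<noteq> 0"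
    by (metis fps_zero_nth zero_neq_one)
  ultimately show ?thesis by simp
qed

text \<open>A nonzero constant term makes \<open>c\<close> a unit, so dividing by it is multiplying
  by \<open>inverse c\<close>.\<close>

lemma fps_eq_divide_mult_unit:
  fixes a b c d :: "'a :: field fps"
  assumes "c * a = b * d" "fps_nth c 0 \<noteq> 0"
  shows "a = b / c * d"
proof -
  have "a = inverse c * c * a"
    using assms(2) by (simp add: inverse_mult_eq_1)
  also have "\<dots> = inverse c * (b * d)"
    using assms(1) by (simp add: mult.assoc)
  finally show ?thesis
    using assms(2) by (simp add: fps_divide_unit mult_ac)
qed

theorem theorem4p13:
  fixes n :: nat
  assumes "n \<ge> 1"
  shows "poly_at (eulerian_poly n) fps_X =
           (1 + fps_X ^ 2) ^ n / (2 * (1 + fps_X) ^ (n - 1))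
             * poly_at (udr_poly n) (2 * fps_X / (1 + fps_X ^ 2))
    \<and> poly_at (udr_poly n) fps_X =
           2 * (1 + v_series) ^ (n - 1) / (1 + v_series ^ 2) ^ n
             * poly_at (eulerian_poly n) v_series"
proof
  obtain m where n: "n = Suc m"
    using assms by (cases n) auto
  let ?A = "fps_of_poly (eulerian_poly n)" and ?P = "fps_of_poly (udr_poly n)"
  have eq: "(1 + fps_X ^ 2) ^ n * (?P oo u_series) = 2 * (1 + fps_X) ^ (n - 1) * ?A"
    using eulerian_poly_eq_udr_poly_compose[of m] by (simp add: n)
  show "poly_at (eulerian_poly n) fps_X =
      (1 + fps_X ^ 2) ^ n / (2 * (1 + fps_X) ^ (n - 1))
        * poly_at (udr_poly n) (2 * fps_X / (1 + fps_X ^ 2))"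
    unfolding poly_at_def u_series_def[symmetric] fps_compose_fps_X
    by (rule fps_eq_divide_mult_unit) (use eq in \<open>simp_all add: fps_power_zeroth\<close>)
  note v0 = v_series_nth_0
  \<comment> \<open>Composing with \<open>v_series\<close> turns \<open>fps_X\<close> into v and
    \<open>u_series\<close> into \<open>fps_X\<close>, which yields the second identity.\<close>
  have "((1 + fps_X ^ 2) ^ n * (?P oo u_series)) oo v_series =
      (2 * (1 + fps_X) ^ (n - 1) * ?A) oo v_series"
    by (simp only: eq)
  moreover have "?P oo u_series oo v_series = ?P"
    using fps_compose_assoc[OF v0 u_series_nth_0, of ?P] by (simp add: u_series_compose_v_series)
  ultimately have "(1 + v_series ^ 2) ^ n * ?P =
      2 * (1 + v_series) ^ (n - 1) * (?A oo v_series)"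
    using v0
    by (simp add: fps_compose_mult_distrib fps_compose_add_distrib fps_compose_power[symmetric])
  then show "poly_at (udr_poly n) fps_X =
      2 * (1 + v_series) ^ (n - 1) / (1 + v_series ^ 2) ^ n * poly_at (eulerian_poly n) v_series"
    unfolding poly_at_def fps_compose_fps_X
    by (rule fps_eq_divide_mult_unit) (use v0 in \<open>simp add: fps_power_zeroth\<close>)
qed

end
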